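(* Let $T$ be a finite set, and let $a_t$ be an integer for every $t\in T$. Then there exists one and only one finite holey subset $S$ of $\mathbb{Z}$ such that \[ \sum_{t\in T} f_{n+a_t} = \sum_{s\in S} f_{n+s} \] for every $n\in\mathbb{Z}$ which satisfies $n>\max\left(\{-a_t \mid t\in T\}\cup\{-s\mid s\in S\}\right)$.
   Context: A subset $S$ of $\mathbb{Z}$ is called holey if $s+1\notin S$ for every $s\in S$ (i.e., no two elements of $S$ are consecutive integers). $(f_1,f_2,f_3,\dots)$ denotes the Fibonacci sequence, defined by $f_1=f_2=1$ and $f_n=f_{n-1}+f_{n-2}$ for all integers $n\ge 3$; $f_m$ is only defined for positive integers $m$ (the condition on $n$ ensures all indices appearing are positive). *)

theory Defs
  imports "HOL-Number_Theory.Fib"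
begin

definition holey :: "int set \<Rightarrow> bool" where
  "holey S \<longleftrightarrow> (\<forall>s\<in>S. s + 1 \<notin> S)"

end

theory Submission imports Defs begin

text \<open>
  Existence: write \<open>[a]\<close> for the sequence \<open>f\<^bsub>n+a\<^esub>\<close>. The relations \<open>[a] + [a+1] = [a+2]\<close> and
  \<open>2[a] = [a+1] + [a-2]\<close> allow one to rewrite any finite sum of such symbols into a holey one. The
  second relation removes repeated indices: it moves the repetition from \<open>a\<close> to \<open>a-2\<close>, past one
  element of the set. The first removes consecutive indices, and it lowers the number of terms.
  Uniqueness: for a single large \<open>n\<close> it is the uniqueness part of Zeckendorf's theorem, which
  follows from the fact that a holey sum of Fibonacci numbers with indices in \<open>{2..m}\<close> is less
  than \<open>f\<^bsub>m+1\<^esub>\<close>.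
\<close>

section \<open>Two-sided solutions of the Fibonacci recurrence\<close>

definition fibonacci_like :: "(int \<Rightarrow> int) \<Rightarrow> bool" where
  "fibonacci_like h \<longleftrightarrow> (\<forall>n. h (n + 2) = h (n + 1) + h n)"

lemma fibonacci_like_double:
  assumes "fibonacci_like h"
  shows "2 * h a = h (a + 1) + h (a - 2)"
proof -
  have rec: "h (n + 2) = h (n + 1) + h n" for n
    using assms by (simp add: fibonacci_like_def)
  from rec[of "a - 2"] rec[of "a - 1"] show ?thesis
    by (simp add: algebra_simps)
qed

lemma fibonacci_like_shift:
  assumes "fibonacci_like h"
  shows "fibonacci_like (\<lambda>k. h (n + k))"
  using assms by (simp add: fibonacci_like_def flip: add.assoc)

text \<open>Negative indices follow the usual rule
  \<open>fib_int (- k) = (- 1) ^ (k + 1) * fib k\<close>. Rewriting can pass through indices below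
  all given and all final ones, so the recurrence is wanted on the whole of the integers.\<close>

definition fib_int :: "int \<Rightarrow> int" where
  "fib_int n = (if 0 \<le> n then int (fib (nat n)) else (- 1) ^ (nat (- n) + 1) * int (fib (nat (- n))))"

lemma fib_int_nonneg: "0 \<le> n \<Longrightarrow> fib_int n = int (fib (nat n))"
  by (simp add: fib_int_def)

lemma fibonacci_like_fib_int: "fibonacci_like fib_int"
  unfolding fibonacci_like_def
proof
  fix n :: int
  \<comment> \<open>The indices \<open>n\<close>, \<open>n + 1\<close>, \<open>n + 2\<close> are all
    nonnegative, straddle zero, or are all at most zero.\<close>
  consider (nonneg) k where "n = int k" | (m1) "n = -1" | (neg) k where "n = - int (k + 2)"
  proof (cases "n \<ge> 0")
    case True
    then show ?thesis using that(1)[of "nat n"] by simp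
  next
    case False
    then show ?thesis using that(2) that(3)[of "nat (- n) - 2"] by (cases "n = -1") auto
  qed
  then show "fib_int (n + 2) = fib_int (n + 1) + fib_int n"
  proof cases
    case nonneg
    then have "nat (n + 2) = Suc (Suc k)" "nat (n + 1) = Suc k" "nat n = k" by auto
    with nonneg show ?thesis by (simp add: fib_int_def)
  next
    case m1
    then show ?thesis by (simp add: fib_int_def)
  next
    case neg
    then have *: "nat (- n) = Suc (Suc k)" "nat (- n - 1) = Suc k" "nat (- n - 2) = k" by auto
    then have "nat (- (n + 1)) = Suc k" "nat (- (n + 2)) = k" by auto
    with * neg show ?thesis by (cases "k = 0") (auto simp: fib_int_def distrib_left)
  qed
qed

section \<open>Existence: rewriting into holey sets\<close>

lemma holey_subset: "holey S \<Longrightarrow> R \<subseteq> S \<Longrightarrow> holey R"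
  by (auto simp: holey_def)

lemma holey_shift: "holey S \<Longrightarrow> holey ((+) n ` S)"
  by (auto simp: holey_def add.assoc)

lemma holey_rewrite:
  assumes "finite S"
  shows "\<exists>R. finite R \<and> holey R \<and> (\<forall>h. fibonacci_like h \<longrightarrow> sum h S = sum h R)"
  using assms
proof (induction "card S" arbitrary: S rule: less_induct)
  case less
  show ?case
  proof (cases "holey S")
    case True
    with less.prems show ?thesis by blast
  next
    case False
    define C where "C = {s \<in> S. s + 1 \<in> S}"
    have "finite C" "C \<noteq> {}"
      using less.prems False by (auto simp: C_def holey_def)
    \<comment> \<open>The topmost consecutive pair is merged: maximality keeps \<open>m + 2\<close>
      out of \<open>S\<close>, so the merge creates no repeated index.\<close>
    define m where "m = Max C"
    have "m \<in> C"
      unfolding m_def using \<open>finite C\<close> \<open>C \<noteq> {}\<close> by (rule Max_in)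
    then have m: "m \<in> S" "m + 1 \<in> S" by (auto simp: C_def)
    have m2: "m + 2 \<notin> S"
    proof
      assume "m + 2 \<in> S"
      with m have "m + 1 \<in> C" by (simp add: C_def add.assoc)
      with \<open>finite C\<close> have "m + 1 \<le> m" unfolding m_def by (rule Max_ge)
      then show False by simp
    qed
    define D where "D = S - {m, m + 1}"
    have D: "finite D" "m \<notin> D" "m + 1 \<notin> D" "m + 2 \<notin> D" "S = insert m (insert (m + 1) D)"
      using less.prems m m2 by (auto simp: D_def)
    have "card (insert (m + 2) D) < card S"
      using D by simp
    with less.hyps[of "insert (m + 2) D"] D(1) obtain R where R: "finite R" "holey R"
      "\<And>h. fibonacci_like h \<Longrightarrow> sum h (insert (m + 2) D) = sum h R" by auto
    have "sum h S = sum h R" if h: "fibonacci_like h" for h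
      using R(3)[OF h] D h by (simp add: fibonacci_like_def)
    with R(1,2) show ?thesis by blast
  qed
qed

text \<open>
  Holeyness is required only up to \<open>a + 1\<close>, since the replacement of \<open>a\<close> by \<open>a + 1\<close> may create
  consecutive elements above the next index \<open>a - 2\<close>.
\<close>

lemma insert_rewrite:
  assumes "finite S" "holey {s \<in> S. s \<le> a + 1}"
  shows "\<exists>R. finite R \<and> (\<forall>h. fibonacci_like h \<longrightarrow> h a + sum h S = sum h R)"
  using assms
proof (induction "card {s \<in> S. s \<le> a}" arbitrary: S a rule: less_induct)
  case less
  show ?case
  proof (cases "a \<in> S")
    case False
    with less.prems(1) have "\<forall>h. h a + sum h S = sum h (insert a S)" by simp
    with less.prems(1) show ?thesis by blast
  next
    case True
    with less.prems(2) have a1: "a + 1 \<notin> S" by (auto simp: holey_def)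
    define D where "D = S - {a}"
    have D: "finite D" "a \<notin> D" "a + 1 \<notin> D" "S = insert a D"
      using less.prems(1) True a1 by (auto simp: D_def)
    \<comment> \<open>The repetition moves down to \<open>a - 2\<close>, and the elements up to
      there no longer include \<open>a\<close>; the new \<open>a + 1\<close> lies above the
      bound.\<close>
    have "card {s \<in> insert (a + 1) D. s \<le> a - 2} < card {s \<in> S. s \<le> a}"
      using less.prems(1) True by (intro psubset_card_mono) (auto simp: D_def)
    moreover have "holey {s \<in> insert (a + 1) D. s \<le> a - 2 + 1}"
      by (rule holey_subset[OF less.prems(2)]) (auto simp: D_def)
    ultimately obtain R where R: "finite R"
      "\<And>h. fibonacci_like h \<Longrightarrow> h (a - 2) + sum h (insert (a + 1) D) = sum h R"
      using less.hyps[of "insert (a + 1) D" "a - 2"] D(1) by auto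
    have "h a + sum h S = sum h R" if h: "fibonacci_like h" for h
      using R(2)[OF h] D fibonacci_like_double[OF h, of a] by simp
    with R(1) show ?thesis by blast
  qed
qed

text \<open>\<open>S\<close> is chosen before \<open>h\<close>, so one set serves all the shifted
  sequences \<open>h (n + k)\<close>, that is, every \<open>n\<close> at once.\<close>

lemma holey_sum_exists:
  assumes "finite T"
  shows "\<exists>S. finite S \<and> holey S \<and> (\<forall>h. fibonacci_like h \<longrightarrow> (\<Sum>t\<in>T. h (a t)) = sum h S)"
  using assms
proof induction
  case empty
  show ?case by (intro exI[of _ "{}"]) (simp add: holey_def)
next
  case (insert x F)
  then obtain S where S: "finite S" "holey S"
    "\<And>h. fibonacci_like h \<Longrightarrow> (\<Sum>t\<in>F. h (a t)) = sum h S" by blast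
  have "holey {s \<in> S. s \<le> a x + 1}"
    by (rule holey_subset[OF S(2)]) auto
  from insert_rewrite[OF S(1) this] obtain Q where Q: "finite Q"
    "\<And>h. fibonacci_like h \<Longrightarrow> h (a x) + sum h S = sum h Q" by blast
  from holey_rewrite[OF Q(1)] obtain R where R: "finite R" "holey R"
    "\<And>h. fibonacci_like h \<Longrightarrow> sum h Q = sum h R" by blast
  have "(\<Sum>t\<in>insert x F. h (a t)) = sum h R" if h: "fibonacci_like h" for h
    using insert.hyps S(3)[OF h] Q(2)[OF h] R(3)[OF h] by simp
  with R(1,2) show ?case by blast
qed

section \<open>Uniqueness: holey sums with indices from 2 on\<close>

lemma holey_remove_top:
  assumes "holey S" "S \<subseteq> {2..int m}" "int m \<in> S"
  shows "S - {int m} \<subseteq> {2..int (m - 2)}"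
proof
  fix s assume s: "s \<in> S - {int m}"
  with assms have "s \<noteq> int m - 1" by (auto simp: holey_def)
  moreover have "2 \<le> s" "s < int m" using s assms(2) by auto
  ultimately show "s \<in> {2..int (m - 2)}" by auto
qed

text \<open>If \<open>m\<close> occurs, the remaining indices are at most \<open>m - 2\<close>, so
  by induction the sum is below \<open>fib m + fib (m - 1)\<close>. Index 1 must be excluded:
  \<open>S = {1}\<close> with \<open>m = 1\<close> would violate the bound.\<close>

lemma holey_sum_fib_less:
  assumes "holey S" "S \<subseteq> {2..int m}"
  shows "(\<Sum>s\<in>S. fib (nat s)) < fib (Suc m)"
  using assms
proof (induction m arbitrary: S rule: less_induct)
  case (less m)
  have fin: "finite S" using less.prems(2) finite_subset by blast
  show ?case
  proof (cases "int m \<in> S")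
    case True
    with less.prems(2) have m: "2 \<le> m" by auto
    have "(\<Sum>s\<in>S - {int m}. fib (nat s)) < fib (Suc (m - 2))"
      using less.IH[of "m - 2" "S - {int m}"] m holey_remove_top[OF less.prems True]
        holey_subset[OF less.prems(1)] by auto
    moreover have "fib (Suc m) = fib m + fib (Suc (m - 2))"
      using m by (cases m rule: fib.cases) auto
    moreover have "(\<Sum>s\<in>S. fib (nat s)) = fib m + (\<Sum>s\<in>S - {int m}. fib (nat s))"
      using sum.remove[OF fin True, of "\<lambda>s. fib (nat s)"] by simp
    ultimately show ?thesis by simp
  next
    case False
    show ?thesis
    proof (cases "m = 0")
      case True
      with less.prems(2) have "S = {}" by auto
      with True show ?thesis by simp
    next
      case m: False
      have "s \<in> {2..int (m - 1)}" if "s \<in> S" for s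
        using that less.prems(2) False m by (cases "s = int m") auto
      then have "S \<subseteq> {2..int (m - 1)}" by blast
      with less.IH[of "m - 1" S] m less.prems(1) have "(\<Sum>s\<in>S. fib (nat s)) < fib m" by auto
      also have "\<dots> \<le> fib (Suc m)" by (rule fib_mono) simp
      finally show ?thesis .
    qed
  qed
qed

text \<open>A set containing \<open>m\<close> has sum at least \<open>fib m\<close>, and a holey one
  within the range but without \<open>m\<close> has a smaller sum. Hence \<open>m\<close> lies in
  both sets or in neither, and induction treats the rest.\<close>

lemma holey_sum_fib_inject:
  assumes "holey S" "S \<subseteq> {2..int m}" "holey R" "R \<subseteq> {2..int m}"
    and "(\<Sum>s\<in>S. fib (nat s)) = (\<Sum>s\<in>R. fib (nat s))"
  shows "S = R"
  using assms
proof (induction m arbitrary: S R rule: less_induct)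
  case (less m)
  have fin: "finite S" "finite R" using less.prems(2,4) finite_subset by blast+
  have low: "X \<subseteq> {2..int (m - 1)}" "0 < m \<or> X = {}"
    if "X \<subseteq> {2..int m}" "int m \<notin> X" for X
  proof -
    have "s \<in> {2..int (m - 1)}" "0 < m" if "s \<in> X" for s
      using that \<open>X \<subseteq> {2..int m}\<close> \<open>int m \<notin> X\<close> by (cases "s = int m"; force)+
    then show "X \<subseteq> {2..int (m - 1)}" "0 < m \<or> X = {}" by auto
  qed
  have top: "int m \<in> Y"
    if "int m \<in> X" "X \<subseteq> {2..int m}" "finite X" "holey Y" "Y \<subseteq> {2..int m}"
      "(\<Sum>s\<in>X. fib (nat s)) = (\<Sum>s\<in>Y. fib (nat s))" for X Y
  proof (rule ccontr)
    assume "int m \<notin> Y"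
    have "0 < m" using that(1,2) by auto
    have "fib m \<le> (\<Sum>s\<in>X. fib (nat s))"
      using member_le_sum[OF that(1), of "\<lambda>s. fib (nat s)"] that(3) by simp
    also have "\<dots> < fib (Suc (m - 1))"
      unfolding that(6) by (rule holey_sum_fib_less[OF that(4) low(1)[OF that(5) \<open>int m \<notin> Y\<close>]])
    finally show False using \<open>0 < m\<close> by simp
  qed
  show ?case
  proof (cases "int m \<in> S")
    case True
    then have R: "int m \<in> R" using top[of S R] less.prems fin by simp
    have "0 < m" using True less.prems(2) by auto
    have "(\<Sum>s\<in>S - {int m}. fib (nat s)) = (\<Sum>s\<in>R - {int m}. fib (nat s))"
      using sum.remove[OF fin(1) True, of "\<lambda>s. fib (nat s)"]
        sum.remove[OF fin(2) R, of "\<lambda>s. fib (nat s)"] less.prems(5) by simp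
    then have "S - {int m} = R - {int m}"
      using less.IH[of "m - 2" "S - {int m}" "R - {int m}"] \<open>0 < m\<close>
        holey_remove_top[OF less.prems(1,2) True] holey_remove_top[OF less.prems(3,4) R]
        holey_subset[OF less.prems(1)] holey_subset[OF less.prems(3)] by auto
    with True R show ?thesis by blast
  next
    case False
    then have R: "int m \<notin> R" using top[of R S] less.prems fin by auto
    show ?thesis
    proof (cases "m = 0")
      case True
      with low(2) False R less.prems show ?thesis by auto
    next
      case m: False
      with less.IH[of "m - 1" S R] low(1) False R less.prems show ?thesis by simp
    qed
  qed
qed

theorem theorem1:
  fixes T :: "'a set" and a :: "'a \<Rightarrow> int"
  assumes "finite T"
  shows "\<exists>!S :: int set. finite S \<and> holey S \<and>
    (\<forall>n :: int. (\<forall>m \<in> {- a t | t. t \<in> T} \<union> {- s | s. s \<in> S}. n > m) \<longrightarrow>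
      (\<Sum>t\<in>T. fib (nat (n + a t))) = (\<Sum>s\<in>S. fib (nat (n + s))))"
    (is "\<exists>!S. ?P S")
proof -
  obtain S where S: "finite S" "holey S"
    "\<And>h. fibonacci_like h \<Longrightarrow> (\<Sum>t\<in>T. h (a t)) = sum h S"
    using holey_sum_exists[OF assms, of a] by blast
  show ?thesis
  proof (rule ex1I)
    have "(\<Sum>t\<in>T. fib (nat (n + a t))) = (\<Sum>s\<in>S. fib (nat (n + s)))"
      if n: "\<forall>m \<in> {- a t | t. t \<in> T} \<union> {- s | s. s \<in> S}. n > m" for n
    proof -
      have T: "0 \<le> n + a t" if "t \<in> T" for t
      proof -
        have "- a t < n" using n that by blast
        then show ?thesis by simp
      qed
      have S': "0 \<le> n + s" if "s \<in> S" for s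
      proof -
        have "- s < n" using n that by blast
        then show ?thesis by simp
      qed
      \<comment> \<open>All indices are nonnegative here, so \<open>fib\<close> may be exchanged for
        \<open>fib_int\<close>, to which the identity for two-sided sequences applies.\<close>
      have "(\<Sum>t\<in>T. int (fib (nat (n + a t)))) = (\<Sum>t\<in>T. fib_int (n + a t))"
        using T by (intro sum.cong) (auto simp: fib_int_nonneg)
      also have "\<dots> = (\<Sum>s\<in>S. fib_int (n + s))"
        using S(3)[of "\<lambda>k. fib_int (n + k)"] fibonacci_like_shift[OF fibonacci_like_fib_int]
        by simp
      also have "\<dots> = (\<Sum>s\<in>S. int (fib (nat (n + s))))"
        using S' by (intro sum.cong) (auto simp: fib_int_nonneg)
      finally show ?thesis by (simp flip: of_nat_sum)
    qed
    with S(1,2) show P: "?P S" by blast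
    fix R assume R: "?P R"
    define B where "B = a ` T \<union> S \<union> R"
    have "S \<subseteq> B" "R \<subseteq> B" by (auto simp: B_def)
    have "finite B" using assms S(1) R by (simp add: B_def)
    then obtain c where c: "\<And>b. b \<in> B \<Longrightarrow> \<bar>b\<bar> \<le> c"
      using bdd_above_finite[of "abs ` B"] by (auto simp: bdd_above_def)
    \<comment> \<open>A single \<open>n\<close> suffices: it is so large that every shifted index is
      at least 2, which makes it admissible for both \<open>S\<close> and \<open>R\<close> and puts
      the shifted sets in the range of \<open>holey_sum_fib_inject\<close>.\<close>
    define n where "n = \<bar>c\<bar> + 2"
    have n: "n + b \<in> {2..int (nat (2 * n))}" if "b \<in> B" for b
      using c[OF that] by (auto simp: n_def)
    have "- b < n" if "b \<in> B" for b
      using n[OF that] by simp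
    then have above: "\<forall>m \<in> {- a t | t. t \<in> T} \<union> {- s | s. s \<in> X}. n > m" if "X \<subseteq> B" for X
      using that by (auto simp: B_def)
    have "(\<Sum>t\<in>T. fib (nat (n + a t))) = (\<Sum>s\<in>S. fib (nat (n + s)))"
      using P above[of S] \<open>S \<subseteq> B\<close> by blast
    moreover have "(\<Sum>t\<in>T. fib (nat (n + a t))) = (\<Sum>s\<in>R. fib (nat (n + s)))"
      using R above[of R] \<open>R \<subseteq> B\<close> by blast
    ultimately have sums: "(\<Sum>s\<in>(+) n ` R. fib (nat s)) = (\<Sum>s\<in>(+) n ` S. fib (nat s))"
      by (simp add: sum.reindex)
    have "(+) n ` B \<subseteq> {2..int (nat (2 * n))}"
      using n by blast
    then have "(+) n ` R \<subseteq> {2..int (nat (2 * n))}" "(+) n ` S \<subseteq> {2..int (nat (2 * n))}"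
      using image_mono[OF \<open>R \<subseteq> B\<close>, of "(+) n"] image_mono[OF \<open>S \<subseteq> B\<close>, of "(+) n"] by simp_all
    then have "(+) n ` R = (+) n ` S"
      using holey_sum_fib_inject[OF holey_shift _ holey_shift _ sums, of "nat (2 * n)"] S(2) R
      by simp
    then show "R = S" by (simp add: inj_image_eq_iff)
  qed
qed

end
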